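(* Let $V=[a,b]\subset\mathbb{R}$, $k\ge 1$, let $F:V^k\to V$ be continuous and monotonic in each of its arguments, and let $\tau:\{1,\ldots,k\}\to\{-1,1\}$ be such that $F$ is increasing with respect to $\leq_\tau$ (that is, $X\leq_\tau Y\Rightarrow F(X)\le F(Y)$). Consider the difference equation $x_{n+1}=F(x_n,x_{n-1},\ldots,x_{n-k+1})$, $n\ge 0$, with $X_0=(x_0,x_{-1},\ldots,x_{-k+1})\in V^k$. If $F$ has no pseudo-fixed points, then for each $X_0\in V^k$ the omega limit set $\omega(X_0)$ is a fixed point of $F$ (i.e. $\omega(X_0)=\{x\}$ with $F(x,\ldots,x)=x$). In particular, if $F$ has a unique fixed point $x$, then $x$ is a global attractor.
   Context: The ordering $\leq_\tau$ on $V^k$ is: $(x_1,\ldots,x_k)\leq_\tau(y_1,\ldots,y_k)$ iff for all $i$, $x_i\le y_i$ when $\tau(i)=1$ and $x_i\ge y_i$ when $\tau(i)=-1$. The map $G_\tau:V^k\times V^k\to V^k\times V^k$ is defined, for $X=(x_1,\ldots,x_k)$, $U=(u_1,\ldots,u_k)$, as follows. For $1\le i\le k-1$ put $y_{i+1}=x_i$, $z_{i+1}=u_i$ if $\tau(i)\tau(i+1)=1$, and $y_{i+1}=u_i$, $z_{i+1}=x_i$ if $\tau(i)\tau(i+1)=-1$. If $\tau(1)=1$, $G_\tau(X,U)=(F(X),y_2,\ldots,y_k,F(U),z_2,\ldots,z_k)$; if $\tau(1)=-1$, $G_\tau(X,U)=(F(U),y_2,\ldots,y_k,F(X),z_2,\ldots,z_k)$.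 For $x,y\in V$ let $P_\tau\in V^k$ have $i$-th entry $x$ if $\tau(i)=1$ and $y$ if $\tau(i)=-1$, and let $P_\tau^t$ be obtained from $P_\tau$ by switching $x$ and $y$. Fixed points of $G_\tau$ have the form $(P_\tau,P_\tau^t)$; those with $x\ne y$ are called pseudo-fixed points of $F$. A fixed point of $F$ is $x\in V$ with $F(x,\ldots,x)=x$. $\omega(X_0)$ is the set of limit points of the orbit $\{x_n\}$ of $X_0$. A fixed point $x$ is a global attractor if every orbit, for every $X_0\in V^k$, converges to $x$. *)

theory Defs
  imports "HOL-Analysis.Analysis"
begin

text \<open>
  A point of V^k is a function on the index set {1..k}, extended by \<^term>\<open>undefined\<close> elsewhere, so
  that equality of functions is equality of tuples and the product topology of
  \<^theory>\<open>HOL-Analysis.Function_Topology\<close> induces on V^k the usual topology.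
\<close>

definition tuples :: "nat \<Rightarrow> real set \<Rightarrow> (nat \<Rightarrow> real) set" where
  "tuples k V = {1..k} \<rightarrow>\<^sub>E V"

definition monotonic_in_each :: "nat \<Rightarrow> real set \<Rightarrow> ((nat \<Rightarrow> real) \<Rightarrow> real) \<Rightarrow> bool" where
  "monotonic_in_each k V F \<longleftrightarrow>
     (\<forall>i\<in>{1..k}. (\<forall>X\<in>tuples k V. mono_on V (\<lambda>t. F (X(i := t)))) \<or>
                 (\<forall>X\<in>tuples k V. antimono_on V (\<lambda>t. F (X(i := t)))))"

definition tau_le :: "nat \<Rightarrow> (nat \<Rightarrow> int) \<Rightarrow> (nat \<Rightarrow> real) \<Rightarrow> (nat \<Rightarrow> real) \<Rightarrow> bool" where
  "tau_le k \<tau> X Y \<longleftrightarrow>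
     (\<forall>i\<in>{1..k}. (\<tau> i = 1 \<longrightarrow> X i \<le> Y i) \<and> (\<tau> i = -1 \<longrightarrow> X i \<ge> Y i))"

definition G_tau :: "nat \<Rightarrow> (nat \<Rightarrow> int) \<Rightarrow> ((nat \<Rightarrow> real) \<Rightarrow> real) \<Rightarrow>
    (nat \<Rightarrow> real) \<times> (nat \<Rightarrow> real) \<Rightarrow> (nat \<Rightarrow> real) \<times> (nat \<Rightarrow> real)" where
  "G_tau k \<tau> F = (\<lambda>(X, U).
     (\<lambda>i\<in>{1..k}. if i = 1 then (if \<tau> 1 = 1 then F X else F U)
                 else (if \<tau> (i - 1) * \<tau> i = 1 then X (i - 1) else U (i - 1)),
      \<lambda>i\<in>{1..k}. if i = 1 then (if \<tau> 1 = 1 then F U else F X)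
                 else (if \<tau> (i - 1) * \<tau> i = 1 then U (i - 1) else X (i - 1))))"

text \<open>The switched tuple is \<open>P_tau k \<tau> y x\<close>.\<close>

definition P_tau :: "nat \<Rightarrow> (nat \<Rightarrow> int) \<Rightarrow> real \<Rightarrow> real \<Rightarrow> nat \<Rightarrow> real" where
  "P_tau k \<tau> x y = (\<lambda>i\<in>{1..k}. if \<tau> i = 1 then x else y)"

definition pseudo_fixed_points ::
    "nat \<Rightarrow> real set \<Rightarrow> (nat \<Rightarrow> int) \<Rightarrow> ((nat \<Rightarrow> real) \<Rightarrow> real) \<Rightarrow>
     ((nat \<Rightarrow> real) \<times> (nat \<Rightarrow> real)) set" where
  "pseudo_fixed_points k V \<tau> F =
     {(P_tau k \<tau> x y, P_tau k \<tau> y x) | x y.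
        x \<in> V \<and> y \<in> V \<and> x \<noteq> y \<and>
        G_tau k \<tau> F (P_tau k \<tau> x y, P_tau k \<tau> y x) = (P_tau k \<tau> x y, P_tau k \<tau> y x)}"

definition fixed_point :: "nat \<Rightarrow> real set \<Rightarrow> ((nat \<Rightarrow> real) \<Rightarrow> real) \<Rightarrow> real \<Rightarrow> bool" where
  "fixed_point k V F x \<longleftrightarrow> x \<in> V \<and> F (\<lambda>i\<in>{1..k}. x) = x"

lemma restrict_fundef_cong [fundef_cong]:
  "I = J \<Longrightarrow> (\<And>i. i \<in> J \<Longrightarrow> f i = g i) \<Longrightarrow> restrict f I = restrict g J"
  by (auto simp: restrict_def)

text \<open>
  The solution of the difference equation with initial tuple X = (x_0, x_{-1}, ..., x_{-k+1}), indexed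
  by the integers. The i-th entry of X is x_{1-i}, and x_n = F (x_{n-1}, ..., x_{n-k}) for positive n.
\<close>

function orbit :: "nat \<Rightarrow> ((nat \<Rightarrow> real) \<Rightarrow> real) \<Rightarrow> (nat \<Rightarrow> real) \<Rightarrow> int \<Rightarrow> real" where
  "orbit k F X n =
     (if n \<le> 0 then X (nat (1 - n)) else F (\<lambda>i\<in>{1..k}. orbit k F X (n - int i)))"
  by auto
termination
  by (relation "Wellfounded.measure (\<lambda>(k, F, X, n). nat n)") auto

declare orbit.simps [simp del]

text \<open>Limit points are those of the sequence: an eventually constant orbit has its final value as limit point.\<close>

definition omega_limit :: "nat \<Rightarrow> ((nat \<Rightarrow> real) \<Rightarrow> real) \<Rightarrow> (nat \<Rightarrow> real) \<Rightarrow> real set" where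
  "omega_limit k F X =
     {l. \<exists>r :: nat \<Rightarrow> nat. strict_mono r \<and> (\<lambda>n. orbit k F X (int (r n))) \<longlonglongrightarrow> l}"

definition global_attractor :: "nat \<Rightarrow> real set \<Rightarrow> ((nat \<Rightarrow> real) \<Rightarrow> real) \<Rightarrow> real \<Rightarrow> bool" where
  "global_attractor k V F x \<longleftrightarrow>
     fixed_point k V F x \<and>
     (\<forall>X\<in>tuples k V. (\<lambda>n. orbit k F X (int n)) \<longlonglongrightarrow> x)"

end

theory Submission
  imports Defs
begin

text \<open>
  Put \<open>\<Phi>(x, y) = F (P_tau k \<tau> x y)\<close>, which increases in \<open>x\<close> and decreases in \<open>y\<close>. Starting from
  \<open>(p, q) = (b, a)\<close> and iterating \<open>(p, q) \<mapsto> (\<Phi>(p, q), \<Phi>(q, p))\<close>, the upper bounds \<open>p\<close> decrease and the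
  lower bounds \<open>q\<close> increase, so they converge to limits \<open>x\<close> and \<open>y\<close> with \<open>\<Phi>(x, y) = x\<close> and
  \<open>\<Phi>(y, x) = y\<close>. Without pseudo-fixed points \<open>x = y\<close>. Every orbit enters the \<open>n\<close>-th interval \<open>[q, p]\<close>
  after \<open>n\<close> blocks of \<open>k\<close> steps, hence converges to \<open>x\<close>.
\<close>

lemma P_tau_in_tuples: "x \<in> V \<Longrightarrow> y \<in> V \<Longrightarrow> P_tau k \<tau> x y \<in> tuples k V"
  by (auto simp: P_tau_def tuples_def)

lemma P_tau_diagonal: "P_tau k \<tau> x x = (\<lambda>i\<in>{1..k}. x)"
  by (simp add: P_tau_def)

lemma tau_le_P_tau: "x \<le> x' \<Longrightarrow> y' \<le> y \<Longrightarrow> tau_le k \<tau> (P_tau k \<tau> x y) (P_tau k \<tau> x' y')"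
  by (auto simp: tau_le_def P_tau_def)

text \<open>The extreme corners of the cube of tuples with entries between \<open>q\<close> and
  \<open>p\<close>: where the sign is -1 the order is reversed, so the bottom corner carries
  \<open>p\<close> there and the top corner \<open>q\<close>.\<close>

lemma tau_le_P_tau_bounds:
  assumes "\<And>i. i \<in> {1..k} \<Longrightarrow> q \<le> X i \<and> X i \<le> p"
  shows "tau_le k \<tau> (P_tau k \<tau> q p) X" and "tau_le k \<tau> X (P_tau k \<tau> p q)"
  using assms by (auto simp: tau_le_def P_tau_def)

lemma continuous_on_P_tau: "continuous_on S (\<lambda>(x, y). P_tau k \<tau> x y)"
proof (rule continuous_on_coordinatewise_then_product)
  fix i
  consider "i \<in> {1..k}" "\<tau> i = 1" | "i \<in> {1..k}" "\<tau> i \<noteq> 1" | "i \<notin> {1..k}" by blast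
  then show "continuous_on S (\<lambda>z. (case z of (x, y) \<Rightarrow> P_tau k \<tau> x y) i)"
    by cases (simp_all add: P_tau_def case_prod_unfold continuous_intros del: atLeastAtMost_iff)
qed

text \<open>Moving from entry \<open>i - 1\<close> to entry \<open>i\<close> swaps the two values
  exactly when the sign changes, and \<open>G_tau\<close> then reads from the other tuple. The shift
  thus preserves the pair, and only the first entries impose equations.\<close>

lemma G_tau_fixed_point_P_tau:
  assumes "\<tau> \<in> {1..k} \<rightarrow> {-1, 1}"
    and "F (P_tau k \<tau> x y) = x" and "F (P_tau k \<tau> y x) = y"
  shows "G_tau k \<tau> F (P_tau k \<tau> x y, P_tau k \<tau> y x) = (P_tau k \<tau> x y, P_tau k \<tau> y x)"
proof -
  have sign: "\<tau> i = 1 \<or> \<tau> i = -1" if "1 \<le> i" "i \<le> k" for i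
    using assms(1) that by (auto simp: Pi_iff)
  have prev: "P_tau k \<tau> u v (i - 1) =
      (if \<tau> (i - 1) * \<tau> i = 1 then P_tau k \<tau> u v i else P_tau k \<tau> v u i)"
    if "i \<in> {1..k}" "i \<noteq> 1" for u v i
    using sign[of i] sign[of "i - 1"] that by (auto simp: P_tau_def)
  have first: "F (P_tau k \<tau> x y) = P_tau k \<tau> x y 1 \<and> F (P_tau k \<tau> y x) = P_tau k \<tau> y x 1"
    if "1 \<le> k" "\<tau> 1 = 1"
    using that assms by (simp add: P_tau_def)
  have first': "F (P_tau k \<tau> x y) = P_tau k \<tau> y x 1 \<and> F (P_tau k \<tau> y x) = P_tau k \<tau> x y 1"
    if "1 \<le> k" "\<tau> 1 \<noteq> 1"
    using that assms by (simp add: P_tau_def)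
  have outside: "P_tau k \<tau> u v i = undefined" if "i \<notin> {1..k}" for u v i
    using that by (simp add: P_tau_def del: atLeastAtMost_iff)
  \<comment> \<open>The two components of \<open>G_tau\<close> differ by exchanging the tuples, so
    one claim in \<open>u\<close> and \<open>v\<close> serves both.\<close>
  have "(\<lambda>i\<in>{1..k}. if i = 1 then (if \<tau> 1 = 1 then F (P_tau k \<tau> u v) else F (P_tau k \<tau> v u))
        else (if \<tau> (i - 1) * \<tau> i = 1 then P_tau k \<tau> u v (i - 1) else P_tau k \<tau> v u (i - 1)))
      = P_tau k \<tau> u v" if "(u, v) = (x, y) \<or> (u, v) = (y, x)" for u v
  proof
    fix i
    consider "i \<notin> {1..k}" | "i = 1" "1 \<le> k" | "i \<in> {1..k}" "i \<noteq> 1" by fastforce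
    then show "(\<lambda>i\<in>{1..k}. if i = 1 then (if \<tau> 1 = 1 then F (P_tau k \<tau> u v) else F (P_tau k \<tau> v u))
        else (if \<tau> (i - 1) * \<tau> i = 1 then P_tau k \<tau> u v (i - 1) else P_tau k \<tau> v u (i - 1))) i
      = P_tau k \<tau> u v i"
    proof cases
      case 1 then show ?thesis by (simp add: outside del: atLeastAtMost_iff)
    next
      case 2 then show ?thesis using first first' that by auto
    next
      case 3 then show ?thesis using prev by simp
    qed
  qed
  then show ?thesis by (simp add: G_tau_def)
qed

lemma pseudo_fixed_point_free_eq:
  assumes "pseudo_fixed_points k V \<tau> F = {}" and "\<tau> \<in> {1..k} \<rightarrow> {-1, 1}"
    and "x \<in> V" "y \<in> V" and "F (P_tau k \<tau> x y) = x" "F (P_tau k \<tau> y x) = y"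
  shows "x = y"
  using assms(1,3,4) G_tau_fixed_point_P_tau[OF assms(2,5,6)]
  unfolding pseudo_fixed_points_def by blast

primrec envelope :: "nat \<Rightarrow> (nat \<Rightarrow> int) \<Rightarrow> ((nat \<Rightarrow> real) \<Rightarrow> real) \<Rightarrow> real \<Rightarrow> real \<Rightarrow> nat \<Rightarrow> real \<times> real" where
  "envelope k \<tau> F a b 0 = (b, a)"
| "envelope k \<tau> F a b (Suc n) =
     (case envelope k \<tau> F a b n of (p, q) \<Rightarrow> (F (P_tau k \<tau> p q), F (P_tau k \<tau> q p)))"

lemma orbit_in_interval_step:
  assumes incr: "\<And>X Y. X \<in> tuples k V \<Longrightarrow> Y \<in> tuples k V \<Longrightarrow> tau_le k \<tau> X Y \<Longrightarrow> F X \<le> F Y"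
    and V: "{q..p} \<subseteq> V" "p \<in> V" "q \<in> V"
    and orb: "\<And>i. i \<in> {1..k} \<Longrightarrow> orbit k F X (n - int i) \<in> {q..p}" and "n > 0"
  shows "orbit k F X n \<in> {F (P_tau k \<tau> q p)..F (P_tau k \<tau> p q)}"
proof -
  define Z where "Z = (\<lambda>i\<in>{1..k}. orbit k F X (n - int i))"
  have "Z \<in> tuples k V"
    using orb V by (auto simp: Z_def tuples_def)
  moreover have "tau_le k \<tau> (P_tau k \<tau> q p) Z" "tau_le k \<tau> Z (P_tau k \<tau> p q)"
    using orb by (intro tau_le_P_tau_bounds; simp add: Z_def)+
  moreover have "orbit k F X n = F Z"
    using \<open>n > 0\<close> by (subst orbit.simps) (simp add: Z_def)
  ultimately show ?thesis
    using incr V by (simp add: P_tau_in_tuples)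
qed

text \<open>The limit \<open>x\<close> comes from the envelope alone, before an initial tuple is
  chosen, so a single fixed point attracts all orbits.\<close>

lemma orbits_tendsto_fixed_point:
  assumes "a \<le> b" and "V = {a..b}"
    and F: "F \<in> tuples k V \<rightarrow> V"
    and cont: "continuous_on (tuples k V) F"
    and \<tau>: "\<tau> \<in> {1..k} \<rightarrow> {-1, 1}"
    and incr: "\<And>X Y. X \<in> tuples k V \<Longrightarrow> Y \<in> tuples k V \<Longrightarrow> tau_le k \<tau> X Y \<Longrightarrow> F X \<le> F Y"
    and pseudo: "pseudo_fixed_points k V \<tau> F = {}"
  obtains x where "fixed_point k V F x"
    and "\<And>X. X \<in> tuples k V \<Longrightarrow> (\<lambda>n. orbit k F X (int n)) \<longlonglongrightarrow> x"
proof -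
  define p where "p n = fst (envelope k \<tau> F a b n)" for n
  define q where "q n = snd (envelope k \<tau> F a b n)" for n
  have p0: "p 0 = b" and q0: "q 0 = a"
    by (simp_all add: p_def q_def)
  have p_Suc: "p (Suc n) = F (P_tau k \<tau> (p n) (q n))"
    and q_Suc: "q (Suc n) = F (P_tau k \<tau> (q n) (p n))" for n
    by (simp_all add: p_def q_def split: prod.split)
  have F_P: "F (P_tau k \<tau> x y) \<in> V" if "x \<in> V" "y \<in> V" for x y
    using F that P_tau_in_tuples by blast
  have F_mono: "F (P_tau k \<tau> x y) \<le> F (P_tau k \<tau> x' y')"
    if "x \<le> x'" "y' \<le> y" "x \<in> V" "x' \<in> V" "y \<in> V" "y' \<in> V" for x y x' y'
    using that by (intro incr P_tau_in_tuples tau_le_P_tau)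
  have in_V: "p n \<in> V \<and> q n \<in> V" for n
    using F_P \<open>a \<le> b\<close> \<open>V = {a..b}\<close> by (induction n) (auto simp: p0 q0 p_Suc q_Suc)
  \<comment> \<open>The induction starts because \<open>p 0\<close> and \<open>q 0\<close> are the
    ends of \<open>V\<close>; monotonicity of \<open>F\<close> then propagates the nesting.\<close>
  have step: "p (Suc n) \<le> p n \<and> q n \<le> q (Suc n)" for n
  proof (induction n)
    case 0
    then show ?case using in_V[of "Suc 0"] \<open>V = {a..b}\<close> by (simp add: p0 q0)
  next
    case (Suc n)
    have "p (Suc (Suc n)) \<le> p (Suc n)"
      using F_mono[of "p (Suc n)" "p n" "q n" "q (Suc n)"] Suc in_V by (simp flip: p_Suc)
    moreover have "q (Suc n) \<le> q (Suc (Suc n))"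
      using F_mono[of "q n" "q (Suc n)" "p (Suc n)" "p n"] Suc in_V by (simp flip: q_Suc)
    ultimately show ?case ..
  qed
  have bounds: "a \<le> p n" "p n \<le> b" "a \<le> q n" "q n \<le> b" for n
    using in_V[of n] \<open>V = {a..b}\<close> by auto
  have "decseq p" "incseq q"
    using step by (auto intro: decseq_SucI incseq_SucI)
  then obtain x y where x: "p \<longlonglongrightarrow> x" and y: "q \<longlonglongrightarrow> y"
    using decseq_convergent[of p a] incseq_convergent[of q b] bounds by metis
  have xy: "x \<in> V" "y \<in> V"
    using closed_sequentially[of V p x] closed_sequentially[of V q y] in_V x y \<open>V = {a..b}\<close> by auto
  have "continuous_on (V \<times> V) (\<lambda>z. F (case z of (u, v) \<Rightarrow> P_tau k \<tau> u v))"
    by (rule continuous_on_compose2[OF cont continuous_on_P_tau]) (auto simp: P_tau_in_tuples)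
  then have F_tendsto: "(\<lambda>n. F (P_tau k \<tau> (f n) (g n))) \<longlonglongrightarrow> F (P_tau k \<tau> u v)"
    if "f \<longlonglongrightarrow> u" "g \<longlonglongrightarrow> v" "u \<in> V" "v \<in> V" "\<And>n. f n \<in> V" "\<And>n. g n \<in> V" for f g u v
    using continuous_on_tendsto_compose[OF _ tendsto_Pair[OF that(1,2)]] that by fastforce
  \<comment> \<open>Both sides are limits of the shifted sequence \<open>p (Suc n)\<close>.\<close>
  have "F (P_tau k \<tau> x y) = x"
    using F_tendsto[OF x y] xy in_V x[THEN LIMSEQ_Suc] by (auto simp: p_Suc intro: LIMSEQ_unique)
  moreover have "F (P_tau k \<tau> y x) = y"
    using F_tendsto[OF y x] xy in_V y[THEN LIMSEQ_Suc] by (auto simp: q_Suc intro: LIMSEQ_unique)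
  ultimately have "x = y" and "fixed_point k V F x"
    using pseudo_fixed_point_free_eq[OF pseudo \<tau> xy] xy
    by (auto simp: fixed_point_def P_tau_diagonal)
  moreover have "(\<lambda>n. orbit k F X (int n)) \<longlonglongrightarrow> x" if X: "X \<in> tuples k V" for X
  proof -
    \<comment> \<open>For \<open>j = 0\<close> the threshold is \<open>1 - k\<close>, the index of
      the oldest initial value; each further \<open>j\<close> costs \<open>k\<close> steps.\<close>
    have orb: "orbit k F X n \<in> {q j..p j}" if "n \<ge> int (j * k) + 1 - int k" for j n
      using that
    proof (induction j arbitrary: n)
      case 0
      show ?case
        using 0
      \<comment> \<open>This base case says that the orbit stays in \<open>V\<close>. Indices
        \<open>n \<le> 0\<close> all have measure 0 and are read off from \<open>X\<close> without
        the induction hypothesis.\<close>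
      proof (induction "nat n" arbitrary: n rule: less_induct)
        case less
        show ?case
        proof (cases "n \<le> 0")
          case True
          then have "nat (1 - n) \<in> {1..k}" using less.prems by auto
          moreover have "orbit k F X n = X (nat (1 - n))"
            using True by (subst orbit.simps) simp
          ultimately show ?thesis
            using X \<open>V = {a..b}\<close> unfolding tuples_def p0 q0 by (metis PiE_mem)
        next
          case False
          then have "orbit k F X n \<in> {F (P_tau k \<tau> a b)..F (P_tau k \<tau> b a)}"
            using less \<open>a \<le> b\<close> \<open>V = {a..b}\<close> incr
            by (intro orbit_in_interval_step[where V = V]) (auto simp: p0 q0)
          then show ?thesis
            using F_P[of a b] F_P[of b a] \<open>a \<le> b\<close> \<open>V = {a..b}\<close> by (auto simp: p0 q0)
        qed
      qed
    next
      case (Suc j)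
      \<comment> \<open>Beyond \<open>j * k\<close>, all \<open>k\<close> preceding indices
        \<open>n - int i\<close> meet the threshold for \<open>j\<close>.\<close>
      have "int (j * k) < n"
        using Suc.prems by simp
      then have "n > 0"
        by (meson le_less_trans of_nat_0_le_iff)
      then show ?case
        unfolding p_Suc q_Suc
        using Suc.prems bounds[of j] in_V[of j] \<open>V = {a..b}\<close>
        by (intro orbit_in_interval_step[OF incr] Suc.IH) auto
    qed
    have late: "orbit k F X (int n) \<in> {q j..p j}" if "n \<ge> Suc (j * k)" for j n
      by (rule orb) (use that in linarith)
    show ?thesis
    \<comment> \<open>One interval per bound \<open>c\<close> suffices: its endpoint already
      separates \<open>c\<close> from all late orbit values.\<close>
    proof (rule order_tendstoI)
      fix c assume "c < x"
      then obtain j where "c < q j"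
        using order_tendstoD(1)[OF y] \<open>x = y\<close> eventually_happens sequentially_bot by blast
      then have "c < orbit k F X (int n)" if "n \<ge> Suc (j * k)" for n
        using late[OF that] by simp
      then show "\<forall>\<^sub>F n in sequentially. c < orbit k F X (int n)"
        by (rule eventually_sequentiallyI)
    next
      fix c assume "x < c"
      then obtain j where "p j < c"
        using order_tendstoD(2)[OF x] eventually_happens sequentially_bot by blast
      then have "orbit k F X (int n) < c" if "n \<ge> Suc (j * k)" for n
        using late[OF that] by simp
      then show "\<forall>\<^sub>F n in sequentially. orbit k F X (int n) < c"
        by (rule eventually_sequentiallyI)
    qed
  qed
  ultimately show thesis
    using that by simp
qed

text \<open>Every subsequence of a convergent sequence has the same limit, and the identity
  subsequence attains it.\<close>

lemma omega_limit_eq_singleton: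
  assumes "(\<lambda>n. orbit k F X (int n)) \<longlonglongrightarrow> x"
  shows "omega_limit k F X = {x}"
proof -
  have sub: "(\<lambda>n. orbit k F X (int (r n))) \<longlonglongrightarrow> x" if "strict_mono r" for r
    using LIMSEQ_subseq_LIMSEQ[OF assms that] by (simp add: o_def)
  have "x \<in> omega_limit k F X"
    using assms by (auto simp: omega_limit_def strict_mono_id intro!: exI[of _ id])
  moreover have "l = x" if "l \<in> omega_limit k F X" for l
    using that LIMSEQ_unique[OF _ sub] by (auto simp: omega_limit_def)
  ultimately show ?thesis by blast
qed

theorem theorem2p11:
  fixes a b :: real and V :: "real set" and k :: nat
    and F :: "(nat \<Rightarrow> real) \<Rightarrow> real" and \<tau> :: "nat \<Rightarrow> int"
  assumes "a \<le> b" and "V = {a..b}" and "k \<ge> 1"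
    and "F \<in> tuples k V \<rightarrow> V"
    and "continuous_on (tuples k V) F"
    and "monotonic_in_each k V F"
    and "\<tau> \<in> {1..k} \<rightarrow> {-1, 1}"
    and "\<forall>X\<in>tuples k V. \<forall>Y\<in>tuples k V. tau_le k \<tau> X Y \<longrightarrow> F X \<le> F Y"
    and "pseudo_fixed_points k V \<tau> F = {}"
  shows "(\<forall>X\<^sub>0\<in>tuples k V. \<exists>x. fixed_point k V F x \<and> omega_limit k F X\<^sub>0 = {x}) \<and>
         (\<forall>x. fixed_point k V F x \<and> (\<forall>y. fixed_point k V F y \<longrightarrow> y = x) \<longrightarrow>
              global_attractor k V F x)"
proof -
  obtain x where x: "fixed_point k V F x"
    and lim: "\<And>X. X \<in> tuples k V \<Longrightarrow> (\<lambda>n. orbit k F X (int n)) \<longlonglongrightarrow> x"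
    using orbits_tendsto_fixed_point[OF assms(1,2,4,5,7) _ assms(9)] assms(8) by blast
  have "\<exists>y. fixed_point k V F y \<and> omega_limit k F X = {y}" if "X \<in> tuples k V" for X
    using x omega_limit_eq_singleton[OF lim[OF that]] by blast
  moreover have "global_attractor k V F x"
    using x lim by (simp add: global_attractor_def)
  ultimately show ?thesis
    \<comment> \<open>Uniqueness identifies the fixed point of the second claim with the attracting
      \<open>x\<close>.\<close>
    using x by blast
qed

end
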